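(* The function $f$ defined on $\mathcal H$ by $$f(z)\,=\,z\,+\,4\,\frac{E_4(z)}{E_4'(z)}$$ satisfies $$f\left(\frac{az+b}{cz+d}\right)\,=\,\frac{af(z)+b}{cf(z)+d},\qquad z\in\mathcal H,\quad \begin{pmatrix}a&b\\c&d\end{pmatrix}\in\mathrm{SL}_2(\mathbb Z).$$
   Context: $\mathcal H=\{z\in\mathbb C:\Im z>0\}$ is the upper half-plane, and $'$ denotes $d/dz$. The Eisenstein series $E_4$ is $E_4(z)=1+240\sum_{n\ge1}\sigma_3(n)e^{2\pi i n z}$, where $\sigma_3(n)$ is the sum of the cubes of the positive divisors of $n$. The function $f$ is meromorphic on $\mathcal H$; the identity is understood between meromorphic functions on $\mathcal H$ (equivalently, with values in the Riemann sphere $\mathbb C\cup\{\infty\}$, on which $\mathrm{SL}_2(\mathbb Z)$ acts by linear fractional transformations). *)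

theory Defs
  imports "HOL-Complex_Analysis.Complex_Analysis"
begin

definition upper_half_plane :: "complex set" where
  "upper_half_plane = {z. Im z > 0}"

definition sigma3 :: "nat \<Rightarrow> nat" where
  "sigma3 n = (\<Sum>d | d dvd n. d ^ 3)"

(* The summation index n \<ge> 1 is written as Suc n.  The series converges (absolutely) only for
   Im z > 0; outside the upper half-plane the value is meaningless. *)
definition E4 :: "complex \<Rightarrow> complex" where
  "E4 z = 1 + 240 * (\<Sum>n. of_nat (sigma3 (Suc n)) *
                           exp (2 * of_real pi * \<i> * of_nat (Suc n) * z))"

(* At a zero of deriv E4 the convention x / 0 = 0 gives this a junk value; the value of the
   meromorphic function that it represents is given by sphere_value below. *)
definition f_E4 :: "complex \<Rightarrow> complex" where
  "f_E4 z = z + 4 * (E4 z / deriv E4 z)"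

(* The Riemann sphere: None is the point at infinity. *)
type_synonym riemann_sphere = "complex option"

(* The value in the Riemann sphere, at the point z, of the meromorphic function represented by g.
   It depends only on g in a punctured neighbourhood of z: it is infinity at a pole, and otherwise
   the limit of g at z, irrespective of the value that g itself happens to have at z. *)
definition sphere_value :: "(complex \<Rightarrow> complex) \<Rightarrow> complex \<Rightarrow> riemann_sphere" where
  "sphere_value g z = (if is_pole g z then None else Some (remove_sings g z))"

(* Linear fractional action of an integer matrix of determinant 1 on the Riemann sphere.
   The numerator a * w + b cannot vanish together with c * w + d, nor a together with c,
   because the determinant is nonzero. *)
fun sphere_action :: "int \<Rightarrow> int \<Rightarrow> int \<Rightarrow> int \<Rightarrow> riemann_sphere \<Rightarrow> riemann_sphere" where
  "sphere_action a b c d (Some w) =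
     (if of_int c * w + of_int d = 0 then None
      else Some ((of_int a * w + of_int b) / (of_int c * w + of_int d)))"
| "sphere_action a b c d None =
     (if c = 0 then None else Some (of_int a / of_int c))"

end

theory Submission
  imports Defs
begin

text \<open>The absolutely convergent lattice sum \<open>G4 z\<close> of \<open>(m z + n)\<close> to the power \<open>-4\<close> is modular of
  weight 4, because \<open>SL\<^sub>2(\<int>)\<close> permutes the lattice. Its row sums are values of the third derivative of
  \<open>\<pi> cot (\<pi> z)\<close>, hence rational functions of \<open>q = exp (2 \<pi> i z)\<close>, and summing the rows as a Lambert
  series gives \<open>G4 = \<pi>^4 / 45 * E4\<close>. Differentiating \<open>E4 (\<gamma> z) = (c z + d)^4 * E4 z\<close> shows that
  \<open>f \<circ> \<gamma>\<close> and \<open>\<gamma> \<circ> f\<close> agree wherever \<open>E4'\<close> vanishes neither at \<open>z\<close> nor at \<open>\<gamma> z\<close>, thus in a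
  punctured neighbourhood of every point; passing to limits in the Riemann sphere gives the claim
  everywhere.\<close>

section \<open>Power series of cubes and a Lambert series\<close>

text \<open>Termwise differentiation keeps convergence in the unit disc, and multiplying by
  \<open>x\<close> afterwards restores the exponent, so each round gains one factor n.\<close>

lemma summable_of_nat_power_mult:
  fixes x :: "'a :: {real_normed_field, banach}"
  assumes "norm x < 1"
  shows "summable (\<lambda>n. of_nat n ^ j * x ^ n)"
  using assms
proof (induction j arbitrary: x)
  case 0
  then show ?case by (simp add: summable_geometric)
next
  case (Suc j)
  have "summable (\<lambda>n. diffs (\<lambda>n. of_nat n ^ j) n * x ^ n)"
    by (rule termdiff_converges[OF Suc.prems Suc.IH])
  then have "summable (\<lambda>n. x * (diffs (\<lambda>n. of_nat n ^ j) n * x ^ n))"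
    by (rule summable_mult)
  also have "(\<lambda>n. x * (diffs (\<lambda>n. of_nat n ^ j) n * x ^ n)) =
      (\<lambda>n. of_nat (Suc n) ^ Suc j * x ^ Suc n)"
    by (simp add: diffs_def algebra_simps)
  finally show ?case
    by (subst (asm) summable_Suc_iff)
qed

text \<open>The operator x d/dx multiplies the n-th coefficient by n. With a closed form
  \<open>f\<close> given, each application reduces to differentiating a rational function.\<close>

lemma sums_of_nat_mult_deriv:
  fixes x :: "'a :: {real_normed_field, banach}"
  assumes "\<And>y. norm y < 1 \<Longrightarrow> (\<lambda>n. c n * y ^ n) sums f y"
    and "(f has_field_derivative f') (at x)" "norm x < 1"
  shows "(\<lambda>n. of_nat n * c n * x ^ n) sums (x * f')"
proof -
  have "(\<lambda>n. x * (diffs c n * x ^ n)) sums (x * f')"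
    by (intro sums_mult termdiffs_sums_strong[OF assms])
  also have "(\<lambda>n. x * (diffs c n * x ^ n)) = (\<lambda>n. of_nat (Suc n) * c (Suc n) * x ^ Suc n)"
    by (simp add: diffs_def algebra_simps)
  finally show ?thesis
    by (subst (asm) sums_Suc_iff) simp
qed

text \<open>Three applications of x d/dx to the geometric series.\<close>

lemma sums_cubes_power:
  fixes x :: "'a :: {real_normed_field, banach}"
  assumes "norm x < 1"
  shows "(\<lambda>n. of_nat n ^ 3 * x ^ n) sums (x * (1 + 4 * x + x ^ 2) / (1 - x) ^ 4)"
proof -
  \<comment> \<open>The factor 1 is written out to expose the coefficient sequence that
    \<open>sums_of_nat_mult_deriv\<close> must match.\<close>
  have s0: "(\<lambda>n. 1 * y ^ n) sums (1 / (1 - y))" if "norm y < 1" for y :: 'a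
    using geometric_sums[OF that] by simp
  have s1: "(\<lambda>n. of_nat n * 1 * y ^ n) sums (y / (1 - y) ^ 2)" if y: "norm y < 1" for y :: 'a
  proof -
    have "1 - y \<noteq> 0" using y by auto
    then have "((\<lambda>y. 1 / (1 - y)) has_field_derivative 1 / (1 - y) ^ 2) (at y)"
      by (auto intro!: derivative_eq_intros simp: power2_eq_square)
    from sums_of_nat_mult_deriv[OF s0 this y] show ?thesis by simp
  qed
  have s2: "(\<lambda>n. of_nat n * (of_nat n * 1) * y ^ n) sums (y * (1 + y) / (1 - y) ^ 3)"
    if y: "norm y < 1" for y :: 'a
  proof -
    define u where "u = 1 - y"
    have u: "y = 1 - u" "u \<noteq> 0" using y by (auto simp: u_def)
    have "((\<lambda>y. y / (1 - y)\<^sup>2) has_field_derivative (1 + y) / (1 - y) ^ 3) (at y)"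
      unfolding u(1) using u(2)
      by (auto intro!: derivative_eq_intros simp: divide_simps)
         (simp add: eval_nat_numeral algebra_simps)
    from sums_of_nat_mult_deriv[OF s1 this y] show ?thesis by simp
  qed
  have "(\<lambda>n. of_nat n * (of_nat n * (of_nat n * 1)) * x ^ n) sums
      (x * (1 + 4 * x + x ^ 2) / (1 - x) ^ 4)"
  proof -
    define u where "u = 1 - x"
    have u: "x = 1 - u" "u \<noteq> 0" using assms by (auto simp: u_def)
    have "((\<lambda>y. y * (1 + y) / (1 - y) ^ 3) has_field_derivative
        (1 + 4 * x + x ^ 2) / (1 - x) ^ 4) (at x)"
      unfolding u(1) using u(2)
      by (auto intro!: derivative_eq_intros simp: divide_simps)
         (simp add: eval_nat_numeral algebra_simps)
    from sums_of_nat_mult_deriv[OF s2 this assms] show ?thesis by simp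
  qed
  then show ?thesis
    by (simp add: power3_eq_cube mult.assoc)
qed

lemma has_sum_cubes_power:
  fixes x :: "'a :: {real_normed_field, banach}"
  assumes "norm x < 1"
  shows "((\<lambda>n. of_nat n ^ 3 * x ^ n) has_sum (x * (1 + 4 * x + x ^ 2) / (1 - x) ^ 4)) {1..}"
proof -
  have "summable (\<lambda>n. norm (of_nat n ^ 3 * x ^ n))"
    using summable_of_nat_power_mult[of "norm x" 3] assms
    by (simp add: norm_mult norm_power)
  then have "((\<lambda>n. of_nat n ^ 3 * x ^ n) has_sum (x * (1 + 4 * x + x ^ 2) / (1 - x) ^ 4)) UNIV"
    by (rule norm_summable_imp_has_sum[OF _ sums_cubes_power[OF assms]])
  then show ?thesis
    by (subst has_sum_cong_neutral[where T = UNIV]) auto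
qed

section \<open>Divisor sums as a Lambert series\<close>

lemma sigma3_le: "n > 0 \<Longrightarrow> sigma3 n \<le> n ^ 4"
proof -
  assume n: "n > 0"
  have "sigma3 n \<le> (\<Sum>d\<in>{1..n}. n ^ 3)"
    unfolding sigma3_def using n dvd_imp_le[of _ n]
    by (intro order.trans[OF sum_mono sum_mono2]) (auto intro!: power_mono Suc_leI Nat.gr0I)
  then show ?thesis by (simp add: power_numeral_reduce)
qed

lemma sigma3_0 [simp]: "sigma3 0 = 0"
proof -
  \<comment> \<open>Every natural number divides 0, and a sum over an infinite set is 0 by
    convention. Series in \<open>sigma3\<close> may therefore start at n = 0.\<close>
  have "infinite {d::nat. d dvd 0}" by simp
  then show ?thesis unfolding sigma3_def by (metis sum.infinite)
qed

lemma summable_norm_sigma3: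
  fixes q :: complex
  assumes "norm q < 1"
  shows "summable (\<lambda>n. norm (of_nat (sigma3 n) * q ^ n))"
proof (rule summable_comparison_test)
  show "summable (\<lambda>n. of_nat n ^ 4 * norm q ^ n)"
    using assms by (intro summable_of_nat_power_mult) simp
  have "norm (norm (of_nat (sigma3 n) * q ^ n)) \<le> of_nat n ^ 4 * norm q ^ n" for n
  proof -
    have "sigma3 n \<le> n ^ 4" using sigma3_le[of n] by (cases "n = 0") auto
    then have "real (sigma3 n) \<le> real n ^ 4" by (metis of_nat_le_iff of_nat_power)
    then show ?thesis by (simp add: norm_mult norm_power mult_right_mono)
  qed
  then show "\<exists>N. \<forall>n\<ge>N. norm (norm (of_nat (sigma3 n) * q ^ n)) \<le> of_nat n ^ 4 * norm q ^ n"
    by blast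
qed

text \<open>Both sides sum d^3 q^n over the pairs (n, d) with d dividing n. Grouping by n gives
  \<open>sigma3\<close>; writing n = m k, d = k and grouping by m gives \<open>g\<close>.\<close>

lemma has_sum_lambert_sigma3:
  fixes q :: complex
  assumes q: "norm q < 1"
    and g: "\<And>m. m \<ge> 1 \<Longrightarrow> ((\<lambda>k. of_nat k ^ 3 * (q ^ m) ^ k) has_sum g m) {1..}"
  shows "(g has_sum (\<Sum>n. of_nat (sigma3 n) * q ^ n)) {1..}"
proof -
  let ?S = "\<Sum>n. of_nat (sigma3 n) * q ^ n"
  define F :: "nat \<times> nat \<Rightarrow> complex" where "F = (\<lambda>(n, d). of_nat d ^ 3 * q ^ n)"
  have fin: "finite {d. d dvd n}" if "n \<in> {1..}" for n :: nat
    using that by simp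
  have row: "((\<lambda>d. F (n, d)) has_sum (of_nat (sigma3 n) * q ^ n)) {d. d dvd n}" if "n \<in> {1..}" for n
    using has_sum_finite[OF fin[OF that], of "\<lambda>d. F (n, d)"]
    by (simp add: F_def sigma3_def sum_distrib_right)
  \<comment> \<open>Within a row all terms are nonnegative multiples of q^n, so their norms add up
    to the norm of the row sum. This yields absolute summability over all pairs.\<close>
  have nrow: "((\<lambda>d. norm (F (n, d))) has_sum (norm (of_nat (sigma3 n) * q ^ n))) {d. d dvd n}"
    if "n \<in> {1..}" for n
    using has_sum_finite[OF fin[OF that], of "\<lambda>d. norm (F (n, d))"]
    by (simp add: F_def sigma3_def sum_distrib_right norm_mult norm_power del: of_nat_sum)
       (simp add: sum_distrib_right)
  have sm: "((\<lambda>n. of_nat (sigma3 n) * q ^ n) has_sum ?S) UNIV"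
    by (intro norm_summable_imp_has_sum summable_sums summable_norm_cancel[OF summable_norm_sigma3]
          summable_norm_sigma3 q)
  have sm1: "((\<lambda>n. of_nat (sigma3 n) * q ^ n) has_sum ?S) {1..}"
    using sm by (subst has_sum_cong_neutral[where T = UNIV]) (auto simp: not_le)
  have nsm: "(\<lambda>n. norm (of_nat (sigma3 n) * q ^ n)) summable_on {1..}"
    by (rule summable_on_subset_banach[OF _ subset_UNIV])
       (use summable_norm_sigma3[OF q] in \<open>auto intro!: norm_summable_imp_summable_on\<close>)
  have "(\<lambda>x. norm (F x)) summable_on (SIGMA n:{1..}. {d. d dvd n})"
    using summable_on_SigmaI[OF nrow nsm] by simp
  then have "F summable_on (SIGMA n:{1..}. {d. d dvd n})"
    by (rule abs_summable_summable)
  with row sm1 have "(F has_sum ?S) (SIGMA n:{1..}. {d. d dvd n})"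
    by (rule has_sum_SigmaI)
  moreover have "bij_betw (\<lambda>(m, k). (m * k, k)) ({1..} \<times> {1..}) (SIGMA n:{1..}. {d::nat. d dvd n})"
  proof (rule bij_betwI[where g = "\<lambda>(n, d). (n div d, d)"])
    have "1 \<le> n div d \<and> 1 \<le> d" if "1 \<le> n" "d dvd n" for n d :: nat
      using that dvd_imp_le[of d n] by (auto simp: Suc_le_eq div_greater_zero_iff intro!: Nat.gr0I)
    then show "(\<lambda>(n, d). (n div d, d)) \<in> (SIGMA n:{1..}. {d::nat. d dvd n}) \<rightarrow> {1..} \<times> {1..}"
      by auto
  qed auto
  ultimately have "((\<lambda>x. F ((\<lambda>(m, k). (m * k, k)) x)) has_sum ?S) ({1..} \<times> {1..})"
    by (subst has_sum_reindex_bij_betw)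
  also have "(\<lambda>x. F ((\<lambda>(m, k). (m * k, k)) x)) = (\<lambda>(m, k). of_nat k ^ 3 * (q ^ m) ^ k)"
    by (auto simp: F_def power_mult)
  finally show ?thesis
    by (rule has_sum_SigmaD) (use g in simp)
qed

section \<open>The cotangent and sums over the integers\<close>

text \<open>Logarithmic derivative of the reflection formula, stated for \<open>rGamma\<close> so
  that both sides are entire.\<close>

lemma Digamma_reflection_complex:
  assumes "z \<notin> \<int>"
  shows "Digamma (1 - z :: complex) - Digamma z = of_real pi * cot (of_real pi * z)"
proof -
  have z: "z \<notin> \<int>\<^sub>\<le>\<^sub>0" "1 - z \<notin> \<int>\<^sub>\<le>\<^sub>0"
    using assms nonpos_Ints_subset_Ints Ints_diff[of 1 "1 - z"] by auto
  have eq: "(\<lambda>z. rGamma z * rGamma (1 - z)) = (\<lambda>z::complex. sin (of_real pi * z) / of_real pi)"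
    by (simp add: rGamma_reflection_complex)
  have d1: "((\<lambda>z. rGamma z * rGamma (1 - z)) has_field_derivative
      rGamma z * rGamma (1 - z) * (Digamma (1 - z) - Digamma z)) (at z)"
    using z by (auto intro!: derivative_eq_intros simp: algebra_simps)
  have d2: "((\<lambda>z::complex. sin (of_real pi * z) / of_real pi) has_field_derivative
      cos (of_real pi * z)) (at z)"
    by (auto intro!: derivative_eq_intros)
  have "rGamma z * rGamma (1 - z) \<noteq> 0"
    using z by (simp add: rGamma_eq_zero_iff)
  then have "sin (of_real pi * z) \<noteq> 0"
    by (auto simp: rGamma_reflection_complex)
  moreover have "sin (of_real pi * z) / of_real pi * (Digamma (1 - z) - Digamma z) = cos (of_real pi * z)"
    using DERIV_unique[OF d1[unfolded eq] d2] by (simp add: rGamma_reflection_complex)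
  ultimately show ?thesis
    by (simp add: cot_def field_simps)
qed

text \<open>Three derivatives of the previous identity, using \<open>cot' = - (1 + cot\<^sup>2)\<close>.\<close>

lemma Polygamma_3_reflection_complex:
  assumes "z \<notin> \<int>"
  shows "Polygamma 3 z + Polygamma 3 (1 - z :: complex) =
    of_real pi ^ 4 * ((1 + cot (of_real pi * z) ^ 2) * (2 + 6 * cot (of_real pi * z) ^ 2))"
proof -
  define c where "c = (\<lambda>z::complex. cot (of_real pi * z))"
  have nonint: "w \<notin> \<int>\<^sub>\<le>\<^sub>0 \<and> 1 - w \<notin> \<int>\<^sub>\<le>\<^sub>0" if "w \<in> - \<int>" for w :: complex
    using that nonpos_Ints_subset_Ints Ints_diff[of 1 "1 - w"] by auto
  have sin: "sin (of_real pi * w) \<noteq> 0" if "w \<in> - \<int>" for w :: complex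
    using nonint[OF that] rGamma_reflection_complex[of w] by (auto simp: rGamma_eq_zero_iff)
  have c: "(c has_field_derivative - (of_real pi * (1 + c w ^ 2))) (at w)" if "w \<in> - \<int>" for w
  proof -
    let ?s = "sin (of_real pi * w)" and ?c = "cos (of_real pi * w)"
    have "?s ^ 2 + ?c ^ 2 = 1"
      by (rule sin_cos_squared_add)
    then have "inverse (?s ^ 2) = 1 + (?c / ?s) ^ 2"
      using sin[OF that] by (simp add: power_divide divide_simps)
    moreover have "((\<lambda>w. cot (of_real pi * w)) has_field_derivative
        - inverse (?s ^ 2) * of_real pi) (at w)"
      by (rule DERIV_chain2[where f = cot])
         (use sin[OF that] in \<open>auto intro!: derivative_eq_intros\<close>)
    moreover have "cot (of_real pi * w) = ?c / ?s"
      by (simp add: cot_def)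
    ultimately show ?thesis
      by (simp add: c_def algebra_simps)
  qed
  have op: "open (- \<int> :: complex set)"
    by (simp add: closed_Ints open_Compl)
  \<comment> \<open>Identities on the open set of non-integers may be differentiated: both sides
    have the same derivative there.\<close>
  have step: "D = D'" if "\<And>w. w \<in> - \<int> \<Longrightarrow> f w = g w" "(f has_field_derivative D) (at w)"
    "(g has_field_derivative D') (at w)" "w \<in> - \<int>" for f g :: "complex \<Rightarrow> complex" and D D' w
    using has_field_derivative_transform_within_open[OF that(2) op that(4), of g] that DERIV_unique
    by blast
  have 0: "Polygamma 0 (1 - w) - Polygamma 0 w = of_real pi * c w" if "w \<in> - \<int>" for w
    using Digamma_reflection_complex[of w] that by (simp add: c_def)
  \<comment> \<open>The inner function 1 - w contributes a sign at every differentiation, so the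
    first term alternates in sign.\<close>
  have 1: "- Polygamma 1 (1 - w) - Polygamma 1 w = - (of_real pi ^ 2 * (1 + c w ^ 2))"
    if w: "w \<in> - \<int>" for w
    by (rule step[OF 0 _ _ w])
       (use nonint[OF w] c[OF w] in \<open>auto intro!: derivative_eq_intros simp: power2_eq_square\<close>)
  have 2: "Polygamma 2 (1 - w) - Polygamma 2 w = of_real pi ^ 3 * (2 * c w * (1 + c w ^ 2))"
    if w: "w \<in> - \<int>" for w
    by (rule step[OF 1 _ _ w])
       (use nonint[OF w] c[OF w] in \<open>auto intro!: derivative_eq_intros simp: eval_nat_numeral algebra_simps\<close>)
  have 3: "- Polygamma 3 (1 - w) - Polygamma 3 w =
      - (of_real pi ^ 4 * ((1 + c w ^ 2) * (2 + 6 * c w ^ 2)))" if w: "w \<in> - \<int>" for w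
    by (rule step[OF 2 _ _ w])
       (use nonint[OF w] c[OF w] in \<open>auto intro!: derivative_eq_intros simp: eval_nat_numeral algebra_simps\<close>)
  have "- (- Polygamma 3 (1 - z) - Polygamma 3 z) =
      of_real pi ^ 4 * ((1 + c z ^ 2) * (2 + 6 * c z ^ 2))"
    by (subst 3) (use assms in auto)
  then show ?thesis
    by (simp add: c_def)
qed

section \<open>Unconditional sums over the integers\<close>

lemma has_sum_int_split:
  fixes f :: "int \<Rightarrow> 'a :: {topological_comm_monoid_add}"
  assumes "((\<lambda>n. f (int n)) has_sum S) UNIV" "((\<lambda>n. f (- int n - 1)) has_sum T) UNIV"
  shows "(f has_sum (S + T)) UNIV"
proof -
  have "(f has_sum S) (range int)"
    using assms(1) by (subst has_sum_reindex) (auto simp: o_def)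
  \<comment> \<open>The map n to -n - 1 enumerates the negative integers, so 0 is counted only
    once.\<close>
  moreover have "(f has_sum T) (range (\<lambda>n. - int n - 1))"
    using assms(2) by (subst has_sum_reindex) (auto simp: o_def inj_on_def)
  moreover have "range int \<inter> range (\<lambda>n. - int n - 1) = {}"
    by auto
  moreover have "n \<in> range int \<union> range (\<lambda>n. - int n - 1)" for n
    by (cases n) (auto simp: image_iff)
  then have "range int \<union> range (\<lambda>n. - int n - 1) = UNIV"
    by blast
  ultimately show ?thesis
    using has_sum_Un_disjoint by metis
qed

lemma has_sum_int_even:
  fixes f :: "int \<Rightarrow> 'a :: {topological_comm_monoid_add}"
  assumes even: "\<And>n. f (- n) = f n" and S: "((\<lambda>n. f (int n)) has_sum S) {1..}"
  shows "(f has_sum (f 0 + S + S)) UNIV"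
proof (rule has_sum_int_split)
  have "((\<lambda>n. f (int n)) has_sum (f (int 0) + S)) ({0} \<union> {1..})"
    by (intro has_sum_Un_disjoint S has_sum_finiteI) auto
  also have "{0} \<union> {1..} = (UNIV :: nat set)"
    by auto
  finally show "((\<lambda>n. f (int n)) has_sum (f 0 + S)) UNIV"
    by simp
  have "((\<lambda>n. f (int n)) has_sum S) (range Suc)"
    using S by (simp add: atLeast_Suc_greaterThan greaterThan_0) 
  then have "((\<lambda>n. f (int (Suc n))) has_sum S) UNIV"
    by (subst (asm) has_sum_reindex) (auto simp: o_def)
  moreover have "f (int (Suc n)) = f (- int n - 1)" for n
    using even[of "- int n - 1"] by (simp add: add.commute)
  ultimately show "((\<lambda>n. f (- int n - 1)) has_sum S) UNIV"
    by simp
qed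

lemma has_sum_int_parity:
  fixes f :: "int \<Rightarrow> 'a :: {topological_comm_monoid_add}"
  assumes "((\<lambda>n. f (2 * n)) has_sum S) UNIV" "((\<lambda>n. f (2 * n + 1)) has_sum T) UNIV"
  shows "(f has_sum (S + T)) UNIV"
proof -
  have "(f has_sum S) (range (\<lambda>n. 2 * n))"
    using assms(1) by (subst has_sum_reindex) (auto simp: o_def inj_on_def)
  moreover have "(f has_sum T) (range (\<lambda>n. 2 * n + 1))"
    using assms(2) by (subst has_sum_reindex) (auto simp: o_def inj_on_def)
  moreover have "range (\<lambda>n. 2 * n) \<inter> range (\<lambda>n::int. 2 * n + 1) = {}"
    by auto presburger
  moreover have "range (\<lambda>n. 2 * n) \<union> range (\<lambda>n::int. 2 * n + 1) = UNIV"
    by (auto simp: image_iff) presburger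
  ultimately show ?thesis
    using has_sum_Un_disjoint by metis
qed

text \<open>\<open>Polygamma 3 w\<close> is 6 times the sum of (w + k)^(-4) over k >= 0. The
  nonnegative integers give w = z; the negative ones give w = 1 - z, since the fourth power ignores
  signs.\<close>

lemma has_sum_inverse_power4_int:
  assumes z: "z \<notin> \<int>" and sm: "(\<lambda>n. inverse ((z + of_int n) ^ 4)) summable_on UNIV"
  shows "((\<lambda>n. inverse ((z + of_int n) ^ 4)) has_sum
    ((Polygamma 3 z + Polygamma 3 (1 - z)) / 6 :: complex)) UNIV"
proof -
  let ?f = "\<lambda>n. inverse ((z + of_int n) ^ 4)"
  have ne: "z \<noteq> 0" "1 - z \<noteq> 0" using z by auto
  have P: "(\<lambda>k. inverse ((w + of_nat k) ^ 4)) sums (Polygamma 3 w / 6)" if "w \<noteq> 0" for w :: complex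
    using Polygamma_LIMSEQ[OF that, of 3] by (simp add: fact_numeral)
  have sm1: "(\<lambda>n. ?f (int n)) summable_on UNIV"
    using summable_on_subset_banach[OF sm subset_UNIV, of "range int"]
    by (subst (asm) summable_on_reindex) (auto simp: o_def)
  have "inj (\<lambda>n. - int n - 1)" by (auto simp: inj_on_def)
  then have sm2: "(\<lambda>n. ?f (- int n - 1)) summable_on UNIV"
    using summable_on_subset_banach[OF sm subset_UNIV, of "range (\<lambda>n. - int n - 1)"]
    by (subst (asm) summable_on_reindex) (auto simp: o_def)
  \<comment> \<open>Summability provides some unconditional sum; the ordinary series identifies its
    value.\<close>
  have "((\<lambda>n. ?f (int n)) has_sum (Polygamma 3 z / 6)) UNIV"
    using has_sum_infsum[OF sm1] has_sum_imp_sums[OF has_sum_infsum[OF sm1]] P[OF ne(1)]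
    by (metis (no_types, lifting) of_int_of_nat_eq sums_cong sums_unique2)
  moreover have "?f (- int n - 1) = inverse ((1 - z + of_nat n) ^ 4)" for n
  proof -
    have "z + of_int (- int n - 1) = - (1 - z + of_nat n)"
      by simp
    then show ?thesis
      by (simp only: power_minus_even even_numeral)
  qed
  then have "((\<lambda>n. ?f (- int n - 1)) has_sum (Polygamma 3 (1 - z) / 6)) UNIV"
    using has_sum_infsum[OF sm2] has_sum_imp_sums[OF has_sum_infsum[OF sm2]] P[OF ne(2)]
    by (metis (no_types, lifting) sums_cong sums_unique2)
  ultimately show ?thesis
    unfolding add_divide_distrib by (rule has_sum_int_split)
qed

section \<open>The Eisenstein series of weight 4\<close>

lemma summable_on_inverse_one_plus_square:
  "(\<lambda>n::int. 1 / (1 + of_int n ^ 2) :: real) summable_on UNIV"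
proof -
  have "summable (\<lambda>n. 1 / real n ^ 2)"
    using inverse_power_summable[of 2, where 'a = real] by (simp add: inverse_eq_divide)
  then have "summable (\<lambda>n. norm (1 / (1 + real n ^ 2)))"
    by (rule summable_comparison_test'[where N = 1])
       (auto simp: abs_of_nonneg intro!: divide_left_mono mult_pos_pos add_pos_nonneg)
  then have "(\<lambda>n. 1 / (1 + of_int (int n) ^ 2) :: real) summable_on UNIV"
    by (intro norm_summable_imp_summable_on) simp
  then have "(\<lambda>n. 1 / (1 + of_int (int n) ^ 2) :: real) summable_on {1..}"
    by (rule summable_on_subset_banach) simp
  then show ?thesis
    using has_sum_int_even[of "\<lambda>n. 1 / (1 + of_int n ^ 2) :: real"] unfolding summable_on_def
    by (metis (no_types, lifting) of_int_minus power2_minus)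
qed

text \<open>A product of two one-variable series, serving as majorant for the lattice sum.\<close>

lemma summable_on_inverse_one_plus_square_product:
  "(\<lambda>(m, n). 1 / ((1 + of_int m ^ 2) * (1 + of_int n ^ 2)) :: real) summable_on (UNIV :: (int \<times> int) set)"
proof -
  let ?h = "\<lambda>n::int. 1 / (1 + of_int n ^ 2) :: real"
  have "(\<lambda>(m, n). ?h m * ?h n) summable_on (UNIV \<times> UNIV)"
  proof (rule summable_on_SigmaI)
    show "((\<lambda>n. (\<lambda>(m, n). ?h m * ?h n) (m, n)) has_sum (?h m * infsum ?h UNIV)) UNIV" for m
      unfolding prod.case
      by (rule has_sum_cmult_right[OF has_sum_infsum[OF summable_on_inverse_one_plus_square]])
    show "(\<lambda>m. ?h m * infsum ?h UNIV) summable_on UNIV"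
      by (intro summable_on_cmult_left summable_on_inverse_one_plus_square)
  qed (auto intro!: mult_nonneg_nonneg divide_nonneg_nonneg)
  then show ?thesis
    by simp
qed

text \<open>At \<open>(m, n) = (0, 0)\<close> the term is \<open>inverse 0 = 0\<close>, so the lattice sum may run over all pairs.\<close>

definition eisenstein_term :: "complex \<Rightarrow> int \<times> int \<Rightarrow> complex" where
  "eisenstein_term z = (\<lambda>(m, n). inverse ((of_int m * z + of_int n) ^ 4))"

definition G4 :: "complex \<Rightarrow> complex" where
  "G4 z = (\<Sum>\<^sub>\<infinity>p. eisenstein_term z p)"

text \<open>With x = Re z, y = Im z and A = m x + n, the squared norm is A^2 + m^2 y^2. Since n = A
  - m x, m^2 + n^2 is at most 2 A^2 + (1 + 2 x^2) m^2; \<open>K\<close> dominates both resulting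
  coefficients.\<close>

lemma lattice_quadratic_bound:
  assumes "Im z > 0"
  defines "K \<equiv> 2 + (1 + 2 * Re z ^ 2) / Im z ^ 2"
  shows "real_of_int m ^ 2 + real_of_int n ^ 2 \<le> K * norm (of_int m * z + of_int n) ^ 2"
proof -
  let ?m = "real_of_int m" and ?n = "real_of_int n"
  define A where "A = ?m * Re z + ?n"
  define Y where "Y = Im z ^ 2"
  have Y: "Y > 0" using assms by (simp add: Y_def)
  have N: "norm (of_int m * z + of_int n) ^ 2 = A ^ 2 + ?m ^ 2 * Y"
    unfolding cmod_power2 by (simp add: A_def Y_def power_mult_distrib)
  \<comment> \<open>The difference of the two sides is (A + m x)^2.\<close>
  have "?n ^ 2 \<le> 2 * A ^ 2 + 2 * (?m ^ 2 * Re z ^ 2)"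
    using zero_le_power2[of "A + ?m * Re z"] by (simp add: A_def power2_eq_square algebra_simps)
  then have "?m ^ 2 + ?n ^ 2 \<le> 2 * A ^ 2 + (1 + 2 * Re z ^ 2) * ?m ^ 2"
    by (simp add: algebra_simps)
  also have "\<dots> = 2 * A ^ 2 + (1 + 2 * Re z ^ 2) / Y * (?m ^ 2 * Y)"
    using Y by simp
  also have "\<dots> \<le> K * A ^ 2 + K * (?m ^ 2 * Y)"
    using Y by (intro add_mono mult_right_mono) (auto simp: K_def Y_def)
  finally show ?thesis
    by (simp only: N distrib_left)
qed

text \<open>Away from the origin s = m^2 + n^2 >= 1, so (1 + m^2)(1 + n^2) <= 1 + s + s^2 <= 3 s^2,
  and s is bounded by the quadratic form. At the origin the term is 0.\<close>

lemma norm_eisenstein_term_le: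
  assumes "Im z > 0"
  obtains C where "\<And>m n. norm (eisenstein_term z (m, n)) \<le>
    C * (1 / ((1 + of_int m ^ 2) * (1 + of_int n ^ 2)))"
proof
  define K where "K = 2 + (1 + 2 * Re z ^ 2) / Im z ^ 2"
  have K: "K \<ge> 0" by (simp add: K_def)
  fix m n :: int
  let ?m = "real_of_int m" and ?n = "real_of_int n" and ?N = "norm (of_int m * z + of_int n)"
  let ?P = "(1 + ?m ^ 2) * (1 + ?n ^ 2)"
  have P: "?P > 0" by (intro mult_pos_pos add_pos_nonneg) auto
  show "norm (eisenstein_term z (m, n)) \<le> (3 * K ^ 2) * (1 / ?P)"
  proof (cases "m = 0 \<and> n = 0")
    case False
    define s where "s = ?m ^ 2 + ?n ^ 2"
    have "m ^ 2 + n ^ 2 \<ge> 1"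
      using False sum_power2_gt_zero_iff[of m n] by linarith
    then have s1: "s \<ge> 1"
      unfolding s_def by (metis of_int_1 of_int_add of_int_le_iff of_int_power)
    have "?P = 1 + s + ?m ^ 2 * ?n ^ 2"
      by (simp add: s_def algebra_simps)
    also have "?m ^ 2 * ?n ^ 2 \<le> s ^ 2"
      unfolding power2_eq_square[of s] by (intro mult_mono) (auto simp: s_def)
    also have "1 + s + s ^ 2 \<le> 3 * s ^ 2"
      using mult_left_mono[of 1 s s] s1 unfolding power2_eq_square by linarith
    also have "s ^ 2 \<le> (K * ?N ^ 2) ^ 2"
      using lattice_quadratic_bound[OF assms, of m n] s1 by (intro power_mono) (auto simp: s_def K_def)
    finally have "?P \<le> 3 * K ^ 2 * ?N ^ 4"
      by (simp add: power_mult_distrib flip: power_mult)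
    \<comment> \<open>The bound itself excludes a zero of m z + n, as its left side is
      positive.\<close>
    moreover from this P have "?N ^ 4 > 0"
      by (cases "?N = 0") (auto simp del: norm_eq_zero)
    moreover have "inverse q \<le> c * (1 / p)" if "0 < p" "0 < q" "p \<le> c * q" for p q c :: real
      using that by (simp add: field_simps)
    ultimately have "inverse (?N ^ 4) \<le> (3 * K ^ 2) * (1 / ?P)"
      using P by blast
    then show ?thesis
      by (simp only: eisenstein_term_def prod.case norm_inverse norm_power)
  qed (use K in \<open>auto simp: eisenstein_term_def\<close>)
qed

lemma abs_summable_eisenstein_term:
  assumes "Im z > 0"
  shows "(\<lambda>p. norm (eisenstein_term z p)) summable_on UNIV"
proof -
  obtain C where C: "\<And>m n. norm (eisenstein_term z (m, n)) \<le>
      C * (1 / ((1 + of_int m ^ 2) * (1 + of_int n ^ 2)))"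
    using norm_eisenstein_term_le[OF assms] by blast
  show ?thesis
    by (rule Infinite_Sum.abs_summable_on_comparison_test'
          [OF summable_on_cmult_right[OF summable_on_inverse_one_plus_square_product, of C]])
       (use C in \<open>auto split: prod.splits\<close>)
qed

lemma summable_eisenstein_term: "Im z > 0 \<Longrightarrow> eisenstein_term z summable_on UNIV"
  by (rule abs_summable_summable[OF abs_summable_eisenstein_term])

text \<open>A row is the lattice family restricted to fixed m. The case m = 0 is included and gives
  the sum of n^(-4) over nonzero n, because \<open>inverse 0 = 0\<close>.\<close>

lemma summable_eisenstein_row:
  assumes "Im z > 0"
  shows "(\<lambda>n. inverse ((of_int m * z + of_int n) ^ 4)) summable_on UNIV"
proof -
  have "eisenstein_term z summable_on range (Pair m)"
    by (rule summable_on_subset_banach[OF summable_eisenstein_term[OF assms]]) simp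
  then show ?thesis
    by (subst (asm) summable_on_reindex) (auto simp: o_def eisenstein_term_def inj_on_def)
qed

text \<open>Replacing z by its image turns m z + n into (m' z + n') / (c z + d), where (m', n') is
  the row vector (m, n) times the matrix; determinant 1 makes this a permutation of the
  lattice.\<close>

lemma G4_moebius:
  fixes a b c d :: int
  assumes det: "a * d - b * c = 1" and z: "Im z > 0" "of_int c * z + of_int d \<noteq> 0"
  shows "G4 ((of_int a * z + of_int b) / (of_int c * z + of_int d)) =
    (of_int c * z + of_int d) ^ 4 * G4 z"
proof -
  let ?j = "of_int c * z + of_int d :: complex"
  let ?\<phi> = "\<lambda>(m, n). (m * a + n * c, m * b + n * d)"
  have bij: "bij_betw ?\<phi> UNIV UNIV"
  proof (rule bij_betwI[where g = "\<lambda>(m, n). (d * m - c * n, a * n - b * m)"])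
    have *: "d * (m * a + n * c) - c * (m * b + n * d) = m * (a * d - b * c)"
      "a * (m * b + n * d) - b * (m * a + n * c) = n * (a * d - b * c)"
      "(d * m - c * n) * a + (a * n - b * m) * c = m * (a * d - b * c)"
      "(d * m - c * n) * b + (a * n - b * m) * d = n * (a * d - b * c)" for m n
      by algebra+
    show "(\<lambda>(m, n). (d * m - c * n, a * n - b * m)) (?\<phi> x) = x" for x
      using * det by (cases x) simp
    show "?\<phi> ((\<lambda>(m, n). (d * m - c * n, a * n - b * m)) x) = x" for x
      using * det by (cases x) simp
  qed auto
  have eq: "eisenstein_term ((of_int a * z + of_int b) / ?j) p = ?j ^ 4 * eisenstein_term z (?\<phi> p)" for p
  proof (cases p)
    case (Pair m n)
    have "of_int m * ((of_int a * z + of_int b) / ?j) + of_int n =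
        (of_int (m * a + n * c) * z + of_int (m * b + n * d)) / ?j"
      using z(2) by (simp add: divide_simps) (simp add: algebra_simps)
    then show ?thesis
      unfolding Pair eisenstein_term_def prod.case
      by (simp only: power_divide inverse_divide) (simp add: divide_inverse)
  qed
  have "G4 ((of_int a * z + of_int b) / ?j) = ?j ^ 4 * (\<Sum>\<^sub>\<infinity>p. eisenstein_term z (?\<phi> p))"
    unfolding G4_def eq by (rule infsum_cmult_right')
  also have "(\<Sum>\<^sub>\<infinity>p. eisenstein_term z (?\<phi> p)) = G4 z"
    unfolding G4_def by (rule infsum_reindex_bij_betw[OF bij])
  finally show ?thesis .
qed

section \<open>Row sums as rational functions of q\<close>

lemma cot_upper_half_plane:
  assumes "Im z > 0"
  defines "q \<equiv> exp (2 * of_real pi * \<i> * z)"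
  shows "q \<noteq> 1" "cot (of_real pi * z) = \<i> * (q + 1) / (q - 1)"
proof -
  define w where "w = exp (\<i> * (of_real pi * z))"
  have qw: "q = w ^ 2"
    unfolding q_def w_def by (simp add: exp_double[symmetric] mult_ac)
  have "norm q < 1"
    using assms by (simp add: norm_exp_eq_Re)
  then show q1: "q \<noteq> 1"
    by auto
  have w: "w \<noteq> 0"
    by (simp add: w_def)
  have sc: "sin (of_real pi * z) = (w - inverse w) / (2 * \<i>)" "cos (of_real pi * z) = (w + inverse w) / 2"
    by (simp_all add: sin_exp_eq cos_exp_eq w_def exp_minus)
  have "w - inverse w = (q - 1) / w" "w + inverse w = (q + 1) / w"
    using w by (simp_all add: qw field_simps power2_eq_square)
  then show "cot (of_real pi * z) = \<i> * (q + 1) / (q - 1)"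
    using w q1 unfolding cot_def sc by (simp add: field_simps)
qed

text \<open>Lipschitz's formula in weight 4. Substituting c = i (q + 1) / (q - 1) into the
  reflection formula gives 16 q (1 + 4 q + q^2) / (1 - q)^4 times pi^4 / 6; this rational function
  generates the cubes.\<close>

lemma lipschitz_formula_4:
  assumes z: "Im z > 0"
  defines "q \<equiv> exp (2 * of_real pi * \<i> * z)"
  shows "((\<lambda>n::int. inverse ((z + of_int n) ^ 4)) has_sum
    (8 * of_real pi ^ 4 / 3 * (q * (1 + 4 * q + q ^ 2) / (1 - q) ^ 4))) UNIV"
proof -
  have nz: "z \<notin> \<int>"
    using z by (auto elim!: Ints_cases)
  define c where "c = cot (of_real pi * z)"
  define u where "u = q - 1"
  have q: "q \<noteq> 1" and c: "c = \<i> * (q + 1) / (q - 1)"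
    using cot_upper_half_plane[OF z] by (auto simp: c_def q_def)
  have u: "u \<noteq> 0" "q = u + 1" using q by (auto simp: u_def)
  have c2: "c ^ 2 = - ((q + 1) ^ 2 / u ^ 2)"
    by (simp add: c u_def power_divide power_mult_distrib)
  define s where "s = 1 + 4 * q + q ^ 2"
  have c1: "1 + c ^ 2 = - 4 * q / u ^ 2"
    unfolding c2 u(2) using u(1) by (simp add: field_simps power2_eq_square)
  have c3: "2 + 6 * c ^ 2 = - 4 * s / u ^ 2"
    unfolding c2 s_def u(2) using u(1) by (simp add: field_simps power2_eq_square)
  have "(1 - q) ^ 4 = (- u) ^ 4"
    by (simp add: u_def)
  then have "(1 + c ^ 2) * (2 + 6 * c ^ 2) = 16 * (q * s / (1 - q) ^ 4)"
    unfolding c1 c3 by (simp flip: power_add)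
  then have "(Polygamma 3 z + Polygamma 3 (1 - z)) / 6 =
      8 * of_real pi ^ 4 / 3 * (q * s / (1 - q) ^ 4)"
    unfolding Polygamma_3_reflection_complex[OF nz] c_def[symmetric] by simp
  moreover have "(\<lambda>n::int. inverse ((z + of_int n) ^ 4)) summable_on UNIV"
    using summable_eisenstein_row[OF z, of 1] by simp
  ultimately show ?thesis
    using has_sum_inverse_power4_int[OF nz] unfolding s_def by metis
qed

text \<open>The sum over odd integers is the row sum at \<open>1/2\<close>, where the cotangent vanishes; the sum over
  even integers is a sixteenth of the whole.\<close>

lemma has_sum_inverse_int_power4:
  "((\<lambda>n::int. inverse (of_int n ^ 4) :: complex) has_sum (of_real pi ^ 4 / 45)) UNIV"
proof -
  let ?f = "\<lambda>n::int. inverse (of_int n ^ 4) :: complex"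
  have sm: "?f summable_on UNIV"
    using summable_eisenstein_row[of \<i> 0] by simp
  then obtain S where S: "(?f has_sum S) UNIV"
    by (auto simp: summable_on_def)
  have half: "(1 / 2 :: complex) \<notin> \<int>"
    using fraction_not_in_Ints[of 2 1, where 'a = complex] by simp
  have "?f (2 * n) = inverse 16 * ?f n" for n
    by (simp add: power_mult_distrib)
  then have even: "((\<lambda>n. ?f (2 * n)) has_sum (inverse 16 * S)) UNIV"
    using has_sum_cmult_right[OF S, of "inverse 16"] by simp
  have odd: "?f (2 * n + 1) = inverse 16 * inverse ((1 / 2 + of_int n) ^ 4)" for n
  proof -
    have "of_int (2 * n + 1) = 2 * (1 / 2 + of_int n :: complex)"
      by simp
    then show ?thesis
      by (simp only: power_mult_distrib inverse_mult_distrib) simp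
  qed
  have "?f summable_on range (\<lambda>n. 2 * n + 1)"
    by (rule summable_on_subset_banach[OF sm]) simp
  then have "(\<lambda>n. ?f (2 * n + 1)) summable_on UNIV"
    by (subst (asm) summable_on_reindex) (auto simp: o_def inj_on_def)
  then have "(\<lambda>n::int. inverse ((1 / 2 + of_int n) ^ 4) :: complex) summable_on UNIV"
    unfolding odd by (subst (asm) summable_on_cmult_right') auto
  from has_sum_inverse_power4_int[OF half this]
  \<comment> \<open>At cotangent 0 the reflection formula leaves 2 pi^4, which is divided by
    6.\<close>
  have "((\<lambda>n::int. inverse ((1 / 2 + of_int n) ^ 4) :: complex) has_sum (of_real pi ^ 4 / 3)) UNIV"
    unfolding Polygamma_3_reflection_complex[OF half] by (simp add: cot_def flip: cos_of_real)
  then have "((\<lambda>n. ?f (2 * n + 1)) has_sum (inverse 16 * (of_real pi ^ 4 / 3))) UNIV"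
    unfolding odd by (rule has_sum_cmult_right)
  from has_sum_int_parity[OF even this]
  have "S = inverse 16 * S + inverse 16 * (of_real pi ^ 4 / 3)"
    using S has_sum_unique by blast
  then have "S = of_real pi ^ 4 / 45"
    by (simp add: field_simps)
  with S show ?thesis by simp
qed

section \<open>The q-expansion of the lattice sum\<close>

lemma norm_nome_less_1: "Im z > 0 \<Longrightarrow> norm (exp (2 * of_real pi * \<i> * z)) < 1"
  by (simp add: norm_exp_eq_Re)

lemma E4_q_expansion:
  assumes "Im z > 0"
  defines "q \<equiv> exp (2 * of_real pi * \<i> * z)"
  shows "E4 z = 1 + 240 * (\<Sum>n. of_nat (sigma3 n) * q ^ n)"
proof -
  have "summable (\<lambda>n. of_nat (sigma3 n) * q ^ n)"
    using summable_norm_cancel[OF summable_norm_sigma3] norm_nome_less_1[OF assms(1)]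
    by (simp add: q_def)
  from suminf_split_head[OF this]
  have "(\<Sum>n. of_nat (sigma3 n) * q ^ n) = (\<Sum>n. of_nat (sigma3 (Suc n)) * q ^ Suc n)"
    by (simp del: power_Suc)
  moreover have "exp (2 * of_real pi * \<i> * of_nat n * z) = q ^ n" for n
    unfolding q_def exp_of_nat_mult[symmetric] by (simp add: mult_ac)
  ultimately show ?thesis
    unfolding E4_def by (simp del: of_nat_Suc power_Suc)
qed

text \<open>Row 0 contributes pi^4 / 45. Row m >= 1 is Lipschitz's formula at m z, whose nome is
  q^m, and row -m equals row m. The constants fit because 2 * 8 / 3 = 240 / 45.\<close>

lemma G4_eq_E4:
  assumes z: "Im z > 0"
  shows "G4 z = of_real pi ^ 4 / 45 * E4 z"
proof -
  define q where "q = exp (2 * of_real pi * \<i> * z)"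
  define h where "h = (\<lambda>m. q ^ m * (1 + 4 * q ^ m + (q ^ m) ^ 2) / (1 - q ^ m) ^ 4)"
  define g where "g = (\<lambda>m. \<Sum>\<^sub>\<infinity>n. eisenstein_term z (m, n))"
  let ?S = "\<Sum>n. of_nat (sigma3 n) * q ^ n"
  have q: "norm q < 1"
    unfolding q_def by (rule norm_nome_less_1[OF z])
  have row: "((\<lambda>n. eisenstein_term z (m, n)) has_sum g m) UNIV" for m
    unfolding g_def eisenstein_term_def prod.case
    by (rule has_sum_infsum[OF summable_eisenstein_row[OF z]])
  have "(eisenstein_term z has_sum G4 z) (UNIV \<times> UNIV)"
    unfolding G4_def UNIV_Times_UNIV by (rule has_sum_infsum[OF summable_eisenstein_term[OF z]])
  from has_sum_SigmaD[OF this row] have G: "(g has_sum G4 z) UNIV" .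
  have g0: "g 0 = of_real pi ^ 4 / 45"
    using has_sum_inverse_int_power4 by (simp add: g_def eisenstein_term_def infsumI)
  have "(h has_sum ?S) {1..}"
  proof (rule has_sum_lambert_sigma3[OF q])
    fix m :: nat assume "m \<ge> 1"
    then have "norm (q ^ m) < 1"
      using q by (simp add: norm_power power_less_one_iff)
    then show "((\<lambda>k. of_nat k ^ 3 * (q ^ m) ^ k) has_sum h m) {1..}"
      unfolding h_def by (rule has_sum_cubes_power)
  qed
  then have "((\<lambda>m. 8 * of_real pi ^ 4 / 3 * h m) has_sum (8 * of_real pi ^ 4 / 3 * ?S)) {1..}"
    by (rule has_sum_cmult_right)
  moreover have "g (int m) = 8 * of_real pi ^ 4 / 3 * h m" if "m \<in> {1..}" for m
  proof -
    have "Im (of_nat m * z) > 0"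
      using that z by simp
    moreover have "exp (2 * of_real pi * \<i> * (of_nat m * z)) = q ^ m"
      unfolding q_def exp_of_nat_mult[symmetric] by (simp add: mult_ac)
    ultimately have "((\<lambda>n. eisenstein_term z (int m, n)) has_sum (8 * of_real pi ^ 4 / 3 * h m)) UNIV"
      using lipschitz_formula_4[of "of_nat m * z"] by (simp add: eisenstein_term_def h_def)
    then show ?thesis
      using row has_sum_unique by blast
  qed
  ultimately have pos: "((\<lambda>m. g (int m)) has_sum (8 * of_real pi ^ 4 / 3 * ?S)) {1..}"
    by (subst has_sum_cong) auto
  \<comment> \<open>Negating m amounts to negating n, as the exponent is even; n is then
    reindexed.\<close>
  have "g (- m) = g m" for m
  proof -
    have "eisenstein_term z (- m, n) = eisenstein_term z (m, - n)" for n
    proof -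
      have "of_int (- m) * z + of_int n = - (of_int m * z + of_int (- n))"
        by simp
      then show ?thesis
        by (simp only: eisenstein_term_def prod.case power_minus_even even_numeral)
    qed
    then have "g (- m) = (\<Sum>\<^sub>\<infinity>n. eisenstein_term z (m, - n))"
      by (simp add: g_def)
    also have "\<dots> = g m"
      unfolding g_def by (rule infsum_reindex_bij_betw[OF bij_uminus])
    finally show ?thesis .
  qed
  from has_sum_int_even[of g, OF this pos] G
  have "G4 z = g 0 + 8 * of_real pi ^ 4 / 3 * ?S + 8 * of_real pi ^ 4 / 3 * ?S"
    using has_sum_unique by blast
  also have "\<dots> = of_real pi ^ 4 / 45 * E4 z"
    unfolding g0 E4_q_expansion[OF z, folded q_def] by (simp add: field_simps)
  finally show ?thesis .
qed

section \<open>Modularity of E4\<close>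

lemma Im_moebius:
  fixes a b c d :: int
  assumes "a * d - b * c = 1" "Im z > 0"
  shows "of_int c * z + of_int d \<noteq> 0" "Im ((of_int a * z + of_int b) / (of_int c * z + of_int d)) > 0"
proof -
  show ne: "of_int c * z + of_int d \<noteq> 0"
  proof
    assume 0: "of_int c * z + of_int d = 0"
    from arg_cong[OF this, of Im] have "of_int c * Im z = 0"
      by simp
    then have "c = 0" using assms(2) by simp
    with 0 assms(1) show False by simp
  qed
  have "real_of_int a * of_int d - of_int b * of_int c = 1"
    using assms(1) by (metis of_int_1 of_int_diff of_int_mult)
  moreover have "of_int a * Im z * (of_int c * Re z + of_int d) - (of_int a * Re z + of_int b) * (of_int c * Im z) =
      Im z * (real_of_int a * of_int d - of_int b * of_int c)"
    by algebra
  \<comment> \<open>The determinant is the factor left over in the imaginary part after clearing the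
    denominator.\<close>
  ultimately have "Im ((of_int a * z + of_int b) / (of_int c * z + of_int d)) =
      Im z / norm (of_int c * z + of_int d) ^ 2"
    by (simp add: Im_divide cmod_power2)
  then show "Im ((of_int a * z + of_int b) / (of_int c * z + of_int d)) > 0"
    using ne assms(2) by simp
qed

lemma E4_moebius:
  fixes a b c d :: int
  assumes "a * d - b * c = 1" "Im z > 0"
  shows "E4 ((of_int a * z + of_int b) / (of_int c * z + of_int d)) =
    (of_int c * z + of_int d) ^ 4 * E4 z"
  using G4_moebius[OF assms Im_moebius(1)[OF assms]] G4_eq_E4[OF assms(2)]
    G4_eq_E4[OF Im_moebius(2)[OF assms]] by simp

section \<open>Values in the Riemann sphere\<close>

lemma sphere_value_tendsto:
  assumes "g \<midarrow>z\<rightarrow> L"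
  shows "sphere_value g z = Some L"
proof -
  have "\<not> is_pole g z"
    unfolding is_pole_def using assms not_tendsto_and_filterlim_at_infinity by (metis at_neq_bot)
  then show ?thesis
    using assms by (simp add: sphere_value_def remove_sings_eqI)
qed

lemma sphere_value_pole: "is_pole g z \<Longrightarrow> sphere_value g z = None"
  by (simp add: sphere_value_def)

text \<open>Sphere values are limits, so they can be pulled back along \<open>\<phi>\<close>. The
  punctured filter at the image matters: \<open>f\<close> may have a meaningless value at the point
  itself.\<close>

lemma sphere_value_compose:
  assumes "not_essential f (\<phi> z)" "filterlim \<phi> (at (\<phi> z)) (at z)"
  shows "sphere_value (\<lambda>w. f (\<phi> w)) z = sphere_value f (\<phi> z)"
proof (cases "is_pole f (\<phi> z)")
  case True
  then have "is_pole (\<lambda>w. f (\<phi> w)) z"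
    unfolding is_pole_def by (rule filterlim_compose[OF _ assms(2)])
  with True show ?thesis
    by (simp add: sphere_value_pole)
next
  case False
  with assms(1) obtain L where L: "f \<midarrow>\<phi> z\<rightarrow> L"
    by (auto simp: not_essential_def)
  then have "(\<lambda>w. f (\<phi> w)) \<midarrow>z\<rightarrow> L"
    by (rule filterlim_compose[OF _ assms(2)])
  with L show ?thesis
    by (simp add: sphere_value_tendsto)
qed

text \<open>Continuity of the action on the sphere, in four cases: the value of \<open>g\<close> and
  its image are each finite or infinite. The relation is assumed only near z, not at z.\<close>

lemma sphere_value_moebius:
  fixes a b c d :: int
  assumes det: "a * d - b * c = 1" and g: "not_essential g z"
    and h: "\<forall>\<^sub>F w in at z. of_int c * g w + of_int d \<noteq> 0 \<and>
      h w = (of_int a * g w + of_int b) / (of_int c * g w + of_int d)"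
  shows "sphere_value h z = sphere_action a b c d (sphere_value g z)"
proof -
  have det': "of_int a * of_int d - of_int b * of_int c = (1 :: complex)"
    using det by (metis of_int_1 of_int_diff of_int_mult)
  let ?n = "\<lambda>w. of_int a * g w + of_int b" and ?d = "\<lambda>w. of_int c * g w + of_int d"
  have ne: "\<forall>\<^sub>F w in at z. ?d w \<noteq> 0" and heq: "\<forall>\<^sub>F w in at z. h w = ?n w / ?d w"
    using h by (auto elim: eventually_mono)
  show ?thesis
  proof (cases "is_pole g z")
    case False
    with g obtain L where L: "g \<midarrow>z\<rightarrow> L"
      by (auto simp: not_essential_def)
    have n: "?n \<midarrow>z\<rightarrow> of_int a * L + of_int b" and d: "?d \<midarrow>z\<rightarrow> of_int c * L + of_int d"
      by (intro tendsto_intros L)+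
    show ?thesis
    proof (cases "of_int c * L + of_int d = 0")
      case True
      have "of_int a * L + of_int b \<noteq> 0"
      proof
        assume "of_int a * L + of_int b = 0"
        with True have "of_int a * of_int d - of_int b * of_int c = (0 :: complex)"
          by algebra
        with det' show False by simp
      qed
      moreover have "filterlim ?d (at 0) (at z)"
        using d ne True by (intro filterlim_atI) simp_all
      ultimately have "filterlim (\<lambda>w. ?n w / ?d w) at_infinity (at z)"
        by (intro filterlim_divide_at_infinity[OF n])
      then have "is_pole h z"
        unfolding is_pole_def using filterlim_cong[OF refl refl heq] by blast
      with True show ?thesis
        by (simp add: sphere_value_tendsto[OF L] sphere_value_pole)
    next
      case False
      then have "(\<lambda>w. ?n w / ?d w) \<midarrow>z\<rightarrow> (of_int a * L + of_int b) / (of_int c * L + of_int d)"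
        by (intro tendsto_divide n d)
      then have "h \<midarrow>z\<rightarrow> (of_int a * L + of_int b) / (of_int c * L + of_int d)"
        using tendsto_cong[OF heq] by blast
      from sphere_value_tendsto[OF this] False show ?thesis
        by (simp add: sphere_value_tendsto[OF L])
    qed
  next
    case True
    then have g: "filterlim g at_infinity (at z)"
      by (simp add: is_pole_def)
    show ?thesis
    proof (cases "c = 0")
      case c: True
      with det' have ad: "of_int a \<noteq> (0 :: complex)" "of_int d \<noteq> (0 :: complex)"
        by auto
      \<comment> \<open>For c = 0 the action is affine with nonzero slope, so it preserves
        poles.\<close>
      have "filterlim (\<lambda>w. of_int a / of_int d * g w + of_int b / of_int d) at_infinity (at z)"
        using ad by (intro tendsto_add_filterlim_at_infinity'[OF _ tendsto_const]
            tendsto_mult_filterlim_at_infinity[OF tendsto_const _ g]) auto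
      also have "(\<lambda>w. of_int a / of_int d * g w + of_int b / of_int d) = (\<lambda>w. ?n w / ?d w)"
        using ad c by (simp add: field_simps)
      finally have "is_pole h z"
        unfolding is_pole_def using filterlim_cong[OF refl refl heq] by blast
      with True c show ?thesis
        by (simp add: sphere_value_pole)
    next
      case c: False
      then have c': "of_int c \<noteq> (0 :: complex)" by simp
      have "filterlim ?d at_infinity (at z)"
        using c' by (intro tendsto_add_filterlim_at_infinity'[OF _ tendsto_const]
            tendsto_mult_filterlim_at_infinity[OF tendsto_const _ g]) auto
      \<comment> \<open>By determinant 1, (a g + b) / (c g + d) = a / c - 1 / (c (c g + d)), which
        makes the limit at a pole visible.\<close>
      then have "(\<lambda>w. of_int a / of_int c - 1 / of_int c / ?d w) \<midarrow>z\<rightarrow> of_int a / of_int c - 0"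
        by (intro tendsto_diff tendsto_const tendsto_divide_0[OF tendsto_const])
      moreover have "\<forall>\<^sub>F w in at z. of_int a / of_int c - 1 / of_int c / ?d w = h w"
        using h
      proof eventually_elim
        case (elim w)
        have "of_int c * ?n w = of_int a * ?d w - (of_int a * of_int d - of_int b * of_int c)"
          by (simp add: algebra_simps)
        then have "?n w = (of_int a * ?d w - 1) / of_int c"
          using c' by (simp add: det' field_simps)
        then have "?n w / ?d w = of_int a / of_int c - 1 / of_int c / ?d w"
          using elim c' by (simp add: diff_divide_distrib divide_divide_eq_left)
        with elim show ?case by simp
      qed
      ultimately have "h \<midarrow>z\<rightarrow> of_int a / of_int c - 0"
        by (rule Lim_transform_eventually)
      from sphere_value_tendsto[OF this] True c show ?thesis
        by (simp add: sphere_value_pole)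
    qed
  qed
qed

section \<open>The equivariant function\<close>

lemma open_upper_half_plane: "open upper_half_plane"
  and connected_upper_half_plane: "connected upper_half_plane"
  unfolding upper_half_plane_def
  by (auto intro: open_halfspace_Im_gt convex_connected convex_halfspace_Im_gt)

text \<open>A power series convergent in the unit disc, composed with the nome.\<close>

lemma E4_holomorphic: "E4 holomorphic_on upper_half_plane"
proof -
  let ?P = "\<lambda>w::complex. \<Sum>n. of_nat (sigma3 n) * w ^ n"
  have "?P field_differentiable at w" if "norm w < 1" for w
    using termdiffs_strong'[OF summable_norm_cancel[OF summable_norm_sigma3] that]
    by (auto simp: field_differentiable_def)
  then have "?P holomorphic_on ball 0 1"
    by (auto simp: holomorphic_on_open field_differentiable_def)
  then have "(?P \<circ> (\<lambda>z. exp (2 * of_real pi * \<i> * z))) holomorphic_on upper_half_plane"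
    by (rule holomorphic_on_compose_gen[rotated])
       (auto intro!: holomorphic_intros norm_nome_less_1 simp: upper_half_plane_def)
  then have "(\<lambda>z. 1 + 240 * (?P \<circ> (\<lambda>z. exp (2 * of_real pi * \<i> * z))) z) holomorphic_on upper_half_plane"
    by (intro holomorphic_intros)
  then show ?thesis
    by (rule holomorphic_transform) (simp add: upper_half_plane_def E4_q_expansion)
qed

lemma deriv_E4_holomorphic: "deriv E4 holomorphic_on upper_half_plane"
  by (rule holomorphic_deriv[OF E4_holomorphic open_upper_half_plane])

lemma E4_has_field_derivative:
  "z \<in> upper_half_plane \<Longrightarrow> (E4 has_field_derivative deriv E4 z) (at z)"
  by (rule holomorphic_derivI[OF E4_holomorphic open_upper_half_plane])

section \<open>The derivative of E4 and its zeros\<close>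

lemma has_field_derivative_moebius:
  fixes a b c d :: int
  assumes "a * d - b * c = 1" "of_int c * z + of_int d \<noteq> (0 :: complex)"
  shows "((\<lambda>z. (of_int a * z + of_int b) / (of_int c * z + of_int d)) has_field_derivative
    1 / (of_int c * z + of_int d) ^ 2) (at z)"
proof -
  have "of_int a * of_int d - of_int b * of_int c = (1 :: complex)"
    using assms(1) by (metis of_int_1 of_int_diff of_int_mult)
  then have "of_int a * (of_int c * z + of_int d) - (of_int a * z + of_int b) * of_int c = 1"
    by algebra
  then show ?thesis
    using assms(2) by (auto intro!: derivative_eq_intros simp: power2_eq_square)
qed

text \<open>Differentiate E4 (\<open>\<phi>\<close> z) = j^4 E4 z, using that \<open>\<phi>\<close>
  has derivative j^(-2). The extra term 4 c E4 is what the summand 4 E4 / \<open>deriv E4\<close> in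
  \<open>f_E4\<close> compensates.\<close>

lemma deriv_E4_moebius:
  fixes a b c d :: int
  assumes det: "a * d - b * c = 1" and z: "z \<in> upper_half_plane"
  defines "j \<equiv> of_int c * z + of_int d"
  shows "deriv E4 ((of_int a * z + of_int b) / j) = j ^ 5 * (4 * of_int c * E4 z + j * deriv E4 z)"
proof -
  let ?\<phi> = "\<lambda>z. (of_int a * z + of_int b) / (of_int c * z + of_int d)"
  have im: "Im z > 0" using z by (simp add: upper_half_plane_def)
  have j: "j \<noteq> 0" and \<phi>: "?\<phi> z \<in> upper_half_plane"
    using Im_moebius[OF det im] by (auto simp: j_def upper_half_plane_def)
  have "((\<lambda>z. E4 (?\<phi> z)) has_field_derivative deriv E4 (?\<phi> z) * (1 / j ^ 2)) (at z)"
    unfolding j_def using j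
    by (intro DERIV_chain2[where f = E4] E4_has_field_derivative[OF \<phi>]
          has_field_derivative_moebius[OF det]) (simp add: j_def)
  then have "((\<lambda>z. (of_int c * z + of_int d) ^ 4 * E4 z) has_field_derivative
      deriv E4 (?\<phi> z) * (1 / j ^ 2)) (at z)"
    by (rule has_field_derivative_transform_within_open[OF _ open_upper_half_plane z])
       (simp add: E4_moebius[OF det] upper_half_plane_def)
  moreover have "((\<lambda>z. (of_int c * z + of_int d) ^ 4 * E4 z) has_field_derivative
      (j ^ 3 * (4 * of_int c * E4 z + j * deriv E4 z))) (at z)"
    by (rule derivative_eq_intros E4_has_field_derivative[OF z] refl)+
       (unfold j_def, simp, algebra)
  ultimately have "deriv E4 (?\<phi> z) * (1 / j ^ 2) = j ^ 3 * (4 * of_int c * E4 z + j * deriv E4 z)"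
    by (rule DERIV_unique)
  then have "deriv E4 (?\<phi> z) = j ^ 2 * (j ^ 3 * (4 * of_int c * E4 z + j * deriv E4 z))"
    using j by (simp add: field_simps)
  then show ?thesis
    unfolding mult.assoc[symmetric] power_add[symmetric] j_def by simp
qed

text \<open>At z = i the nome exp (-2 pi) is positive and all coefficients are nonnegative, so the
  value is real and at least 1.\<close>

lemma E4_ii_nonzero: "E4 \<i> \<noteq> 0"
proof -
  define r where "r = exp (- 2 * pi)"
  have r: "exp (2 * of_real pi * \<i> * \<i>) = complex_of_real r"
    by (simp add: r_def mult.assoc flip: exp_of_real)
  have "summable (\<lambda>n. norm (of_nat (sigma3 n) * complex_of_real r ^ n))"
    by (rule summable_norm_sigma3) (simp add: r_def)
  then have sm: "summable (\<lambda>n. real (sigma3 n) * r ^ n)"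
    by (simp add: norm_mult norm_power r_def)
  have "E4 \<i> = of_real (1 + 240 * (\<Sum>n. real (sigma3 n) * r ^ n))"
    using E4_q_expansion[of \<i>] suminf_of_real[OF sm, where 'a = complex] by (simp add: r)
  moreover have "(\<Sum>n. real (sigma3 n) * r ^ n) \<ge> 0"
    by (rule suminf_nonneg[OF sm]) (simp add: r_def)
  ultimately show ?thesis
    by (simp del: of_real_add of_real_mult)
qed

text \<open>If \<open>deriv E4\<close> vanished identically, the transformation law of the derivative would force \<open>E4 = 0\<close>.\<close>

lemma deriv_E4_nonzero: "\<exists>z\<in>upper_half_plane. deriv E4 z \<noteq> 0"
proof -
  have "\<i> \<in> upper_half_plane"
    by (simp add: upper_half_plane_def)
  then show ?thesis
    \<comment> \<open>The arguments stand for a, d, b, c: the map is z to -1/z, which fixes i and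
      has j = i there. If \<open>deriv E4\<close> vanished at i, then so would E4.\<close>
    using deriv_E4_moebius[of 0 0 "-1" 1 \<i>] E4_ii_nonzero by force
qed

text \<open>Zeros of a holomorphic function that is not identically zero on a connected open set are
  isolated.\<close>

lemma eventually_deriv_E4_nonzero:
  assumes "z \<in> upper_half_plane"
  shows "\<forall>\<^sub>F w in at z. deriv E4 w \<noteq> 0 \<and> w \<in> upper_half_plane"
  using deriv_E4_nonzero non_zero_neighbour_alt[OF deriv_E4_holomorphic open_upper_half_plane
      connected_upper_half_plane assms] by blast

lemma f_E4_meromorphic: "f_E4 meromorphic_on upper_half_plane"
  unfolding f_E4_def[abs_def]
  using E4_holomorphic deriv_E4_holomorphic open_upper_half_plane
  by (intro meromorphic_intros analytic_on_imp_meromorphic_on) (auto simp: analytic_on_open)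

text \<open>Continuity and injectivity; cross-multiplying \<open>\<phi>\<close> w =
  \<open>\<phi>\<close> z leaves (a d - b c)(w - z) = 0.\<close>

lemma filterlim_moebius_at:
  fixes a b c d :: int
  assumes det: "a * d - b * c = 1" and z: "z \<in> upper_half_plane"
  defines "\<phi> \<equiv> \<lambda>z. (of_int a * z + of_int b) / (of_int c * z + of_int d)"
  shows "filterlim \<phi> (at (\<phi> z)) (at z)"
proof (rule filterlim_atI)
  have j: "of_int c * w + of_int d \<noteq> 0" if "w \<in> upper_half_plane" for w
    using Im_moebius(1)[OF det] that by (simp add: upper_half_plane_def)
  show "\<phi> \<midarrow>z\<rightarrow> \<phi> z"
    unfolding \<phi>_def by (intro tendsto_intros j z)
  have "\<phi> w \<noteq> \<phi> z" if w: "w \<in> upper_half_plane" "w \<noteq> z" for w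
  proof
    assume "\<phi> w = \<phi> z"
    then have "(of_int a * w + of_int b) * (of_int c * z + of_int d) =
        (of_int a * z + of_int b) * (of_int c * w + of_int d)"
      using j[OF w(1)] j[OF z] by (simp add: \<phi>_def frac_eq_eq)
    then have "of_int (a * d - b * c) * (w - z) = 0"
      unfolding of_int_diff of_int_mult by algebra
    with det w show False by simp
  qed
  then show "\<forall>\<^sub>F w in at z. \<phi> w \<noteq> \<phi> z"
    using eventually_at_in_open[OF open_upper_half_plane z] by (auto elim: eventually_mono)
qed

lemma f_E4_moebius:
  fixes a b c d :: int
  assumes det: "a * d - b * c = 1" and z: "z \<in> upper_half_plane"
  defines "\<phi> \<equiv> (of_int a * z + of_int b) / (of_int c * z + of_int d)"
  assumes D: "deriv E4 z \<noteq> 0" "deriv E4 \<phi> \<noteq> 0"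
  shows "of_int c * f_E4 z + of_int d \<noteq> 0"
    "f_E4 \<phi> = (of_int a * f_E4 z + of_int b) / (of_int c * f_E4 z + of_int d)"
proof -
  define j where "j = of_int c * z + of_int d"
  define k where "k = 4 * of_int c * E4 z + j * deriv E4 z"
  have det': "of_int a * of_int d - of_int b * of_int c = (1 :: complex)"
    using det by (metis of_int_1 of_int_diff of_int_mult)
  have im: "Im z > 0" using z by (simp add: upper_half_plane_def)
  have j: "j \<noteq> 0" using Im_moebius(1)[OF det im] by (simp add: j_def)
  have D\<phi>: "deriv E4 \<phi> = j ^ 5 * k"
    unfolding \<phi>_def j_def k_def by (rule deriv_E4_moebius[OF det z])
  \<comment> \<open>Nonvanishing of the derivative at \<open>\<phi>\<close> is what keeps c f + d
    away from 0.\<close>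
  with D have k: "k \<noteq> 0" by auto
  have den: "of_int c * f_E4 z + of_int d = k / deriv E4 z"
    using D by (simp add: f_E4_def k_def j_def field_simps)
  then show "of_int c * f_E4 z + of_int d \<noteq> 0"
    using k D by simp
  have num: "of_int a * f_E4 z + of_int b = ((of_int a * z + of_int b) * deriv E4 z + 4 * of_int a * E4 z) / deriv E4 z"
    using D by (simp add: f_E4_def field_simps)
  have "f_E4 \<phi> = (of_int a * z + of_int b) / j + 4 * (j ^ 4 * E4 z / (j ^ 5 * k))"
    unfolding f_E4_def D\<phi> using E4_moebius[OF det im] by (simp add: \<phi>_def j_def)
  also have "\<dots> = ((of_int a * z + of_int b) * k + 4 * E4 z) / (j * k)"
    using j k by (simp add: field_simps eval_nat_numeral)
  \<comment> \<open>The factor j splits off because c (a z + b) + 1 = a (c z + d).\<close>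
  also have "(of_int a * z + of_int b) * k + 4 * E4 z =
      j * ((of_int a * z + of_int b) * deriv E4 z + 4 * of_int a * E4 z)"
    using det' unfolding k_def j_def by algebra
  finally show "f_E4 \<phi> = (of_int a * f_E4 z + of_int b) / (of_int c * f_E4 z + of_int d)"
    unfolding den num using j D by simp
qed

theorem theorem5p4:
  shows "f_E4 meromorphic_on upper_half_plane \<and>
         (\<forall>(a::int) b c d. a * d - b * c = 1 \<longrightarrow>
            (\<forall>z\<in>upper_half_plane.
               sphere_value f_E4 ((of_int a * z + of_int b) / (of_int c * z + of_int d)) =
               sphere_action a b c d (sphere_value f_E4 z)))"
proof (intro conjI allI impI ballI)
  show "f_E4 meromorphic_on upper_half_plane"
    by (rule f_E4_meromorphic)
next
  fix a b c d :: int and z :: complex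
  assume det: "a * d - b * c = 1" and z: "z \<in> upper_half_plane"
  define \<phi> where "\<phi> = (\<lambda>z::complex. (of_int a * z + of_int b) / (of_int c * z + of_int d))"
  have ness: "not_essential f_E4 w" if "w \<in> upper_half_plane" for w
    using meromorphic_on_not_essential meromorphic_on_subset[OF f_E4_meromorphic, of "{w}"] that
    by simp
  have \<phi>z: "\<phi> z \<in> upper_half_plane"
    using Im_moebius(2)[OF det] z by (simp add: \<phi>_def upper_half_plane_def)
  have lim: "filterlim \<phi> (at (\<phi> z)) (at z)"
    unfolding \<phi>_def by (rule filterlim_moebius_at[OF det z])
  \<comment> \<open>The punctured neighbourhood of \<open>\<phi> z\<close> free of zeros is pulled
    back to z.\<close>
  have "\<forall>\<^sub>F w in at z. deriv E4 (\<phi> w) \<noteq> 0"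
    using eventually_compose_filterlim[OF eventually_deriv_E4_nonzero[OF \<phi>z] lim]
    by (auto elim: eventually_mono)
  with eventually_deriv_E4_nonzero[OF z]
  have "\<forall>\<^sub>F w in at z. of_int c * f_E4 w + of_int d \<noteq> 0 \<and>
      f_E4 (\<phi> w) = (of_int a * f_E4 w + of_int b) / (of_int c * f_E4 w + of_int d)"
    unfolding \<phi>_def by eventually_elim (use f_E4_moebius[OF det] in blast)
  then have "sphere_value (\<lambda>w. f_E4 (\<phi> w)) z = sphere_action a b c d (sphere_value f_E4 z)"
    by (rule sphere_value_moebius[OF det ness[OF z]])
  moreover have "sphere_value (\<lambda>w. f_E4 (\<phi> w)) z = sphere_value f_E4 (\<phi> z)"
    by (rule sphere_value_compose[OF ness[OF \<phi>z] lim])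
  ultimately show "sphere_value f_E4 ((of_int a * z + of_int b) / (of_int c * z + of_int d)) =
      sphere_action a b c d (sphere_value f_E4 z)"
    by (simp add: \<phi>_def)
qed

end
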